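(* For any real $\tau,\tau',\xi,\xi'$ satisfying $\xi,\xi'\ge 1/2$, $-\frac14\le\tau\le\xi-\frac34$ and $-\frac14\le\tau'\le\xi'-\frac34$, there exist non-negative Lipschitz continuous functions $f_0,f_1:\mathbb R^2\to[0,\infty)$, with supports contained in $[1/4,3/4]^2$ and with Lipschitz constants $C_{f_0}$ and $C_{f_1}=C_{f_1}(\xi,\xi')$ respectively, such that for any $d\ge 32(\xi\vee\xi')$, $$\frac{\|f_1-f_0\|_{L^2(\mathbb R^2)}}{\|f_0\|_{L^2(\mathbb R^2)}}\ge\frac1{28d},$$ and the data generating model can be written as $$X_{j,\ell}=d^2\eta\int_{I_{j,\ell}}f_1(\xi u-\tau,\xi'v-\tau')\,du\,dv=d^2\eta\int_{I_{j,\ell}}f_0(\xi u-\tau,\xi'v-\tau')\,du\,dv.$$ Consequently, the same pixel values are generated under both classes.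
   Context: The data generating model produces a $d\times d$ image $\mathbf X=(X_{j,\ell})_{j,\ell=1,\dots,d}$ from a template function $f$ via $X_{j,\ell}=d^2\eta\int_{I_{j,\ell}}f(\xi u-\tau,\xi'v-\tau')\,du\,dv$, where $I_{j,\ell}=[\frac{j-1}d,\frac jd)\times[\frac{\ell-1}d,\frac\ell d)$, $\eta>0$ is a brightness factor, $\xi,\xi'$ are scaling parameters and $\tau,\tau'$ are shift parameters; $(\eta,\xi,\xi',\tau,\tau')$ are the random deformation parameters. The functions $f_0,f_1$ play the role of the template functions of the two classes. The support of a function $g$ is $\{x:g(x)\ne0\}$, and $x\vee y=\max\{x,y\}$. "$f$ is Lipschitz continuous with Lipschitz constant $C$" means $|f(u,v)-f(u',v')|\le C\|f\|_1(|u-u'|+|v-v'|)$ for all real $u,v,u',v'$, where $\|f\|_1$ is the $L^1$-norm of $f$ on $[0,1]^2$.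
   Formalization: f_1 is chosen after d (f_0 is not), with C_{f_0} universal and C_{f_1} depending only on ξ, ξ'; a single f_1 for all d is impossible, since equal pixel values for every large d would force f_1 = f_0 on [1/4,3/4]^2. *)

theory Defs
  imports "HOL-Analysis.Analysis"
begin

definition l1_norm_unit_square :: "(real \<times> real \<Rightarrow> real) \<Rightarrow> real" where
  "l1_norm_unit_square f = (LINT z : {0..1} \<times> {0..1} | lborel. \<bar>f z\<bar>)"

definition l2_norm :: "(real \<times> real \<Rightarrow> real) \<Rightarrow> real" where
  "l2_norm f = sqrt (LINT z | lborel. (f z)\<^sup>2)"

(* This is not the library's lipschitz_on: the plane carries the 1-norm distance, and the
   constant is relative to the L1 norm of f on the unit square, which makes it invariant under
   multiplication of f by a positive number. *)
definition lipschitz_with :: "real \<Rightarrow> (real \<times> real \<Rightarrow> real) \<Rightarrow> bool" where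
  "lipschitz_with C f \<longleftrightarrow>
     (\<forall>u v u' v'. \<bar>f (u, v) - f (u', v')\<bar>
        \<le> C * l1_norm_unit_square f * (\<bar>u - u'\<bar> + \<bar>v - v'\<bar>))"

(* Pixels are indexed by j, l in {1..d}; the indices are cast to real before subtracting 1. *)
definition pixel_cell :: "nat \<Rightarrow> nat \<Rightarrow> nat \<Rightarrow> (real \<times> real) set" where
  "pixel_cell d j l =
     {(real j - 1) / real d ..< real j / real d} \<times> {(real l - 1) / real d ..< real l / real d}"

definition pixel_value ::
  "nat \<Rightarrow> real \<Rightarrow> real \<Rightarrow> real \<Rightarrow> real \<Rightarrow> real \<Rightarrow> (real \<times> real \<Rightarrow> real) \<Rightarrow> nat \<Rightarrow> nat \<Rightarrow> real" where
  "pixel_value d \<eta> \<xi> \<xi>' \<tau> \<tau>' f j l =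
     (real d)\<^sup>2 * \<eta> *
     (LINT z : pixel_cell d j l | lborel. f (\<xi> * fst z - \<tau>, \<xi>' * snd z - \<tau>'))"

end

theory Submission
  imports Defs
begin

text \<open>
  Take \<open>f\<^sub>0(x, y) = p(x) p(y)\<close> for a tent function \<open>p\<close> and \<open>f\<^sub>1(x, y) = (p(x) + s(x)) p(y)\<close>. Here
  \<open>s\<close> is a sine wave of amplitude \<open>2h\<close> and period \<open>h = \<xi>/d\<close>, the width of a pixel in the
  coordinates of the template, with its phase fixed by the pixel grid and cut off outside a union
  of whole pixel columns in the middle of the support. It integrates to zero over each pixel, so
  both images agree. Amplitude and period being proportional, its Lipschitz constant does not
  depend on \<open>d\<close>, while its \<open>L\<^sup>2\<close> norm is of order \<open>h\<close>.
\<close>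

section \<open>Products of two functions of one variable\<close>

definition tensor :: "(real \<Rightarrow> real) \<Rightarrow> (real \<Rightarrow> real) \<Rightarrow> real \<times> real \<Rightarrow> real" where
  "tensor f g z = f (fst z) * g (snd z)"

lemma integral_tensor:
  assumes f: "integrable lborel f" and g: "integrable lborel g"
  shows "(LINT z | lborel. tensor f g z) = (LINT x | lborel. f x) * (LINT y | lborel. g y)"
proof -
  have [measurable]: "f \<in> borel_measurable borel" "g \<in> borel_measurable borel"
    using f g by auto
  have m: "tensor f g \<in> borel_measurable (lborel \<Otimes>\<^sub>M lborel)"
    unfolding tensor_def by measurable
  have i: "integrable (lborel \<Otimes>\<^sub>M lborel) (tensor f g)"
  proof (rule lborel_pair.Fubini_integrable[OF m])
    show "integrable lborel (\<lambda>x. LINT y | lborel. norm (tensor f g (x, y)))"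
      using f by (simp add: tensor_def abs_mult)
    show "AE x in lborel. integrable lborel (\<lambda>y. tensor f g (x, y))"
      using g by (simp add: tensor_def)
  qed
  have "(LINT z | lborel. tensor f g z) = (LINT z | (lborel \<Otimes>\<^sub>M lborel). tensor f g z)"
    by (simp add: lborel_prod)
  also have "\<dots> = (LINT x | lborel. LINT y | lborel. tensor f g (x, y))"
    by (rule lborel_pair.integral_fst'[OF i, symmetric])
  finally show ?thesis
    by (simp add: tensor_def)
qed

lemma set_integral_tensor:
  assumes "set_integrable lborel A f" "set_integrable lborel B g"
  shows "(LINT z : A \<times> B | lborel. tensor f g z) = (LINT x : A | lborel. f x) * (LINT y : B | lborel. g y)"
proof -
  have "(\<lambda>z. indicator (A \<times> B) z *\<^sub>R tensor f g z) =
      tensor (\<lambda>x. indicator A x *\<^sub>R f x) (\<lambda>y. indicator B y *\<^sub>R g y)"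
    by (auto simp: tensor_def indicator_def fun_eq_iff)
  then show ?thesis
    using assms by (simp add: set_lebesgue_integral_def set_integrable_def integral_tensor)
qed

text \<open>A product-rule splitting gives slopes \<open>L * B\<close> and \<open>A * M\<close> in
  the two coordinates. Since \<open>lipschitz_with\<close> measures slopes relative to the L1 norm,
  a lower bound \<open>K\<close> on that norm turns these absolute slopes into an admissible
  constant \<open>C\<close>.\<close>

lemma lipschitz_with_tensor:
  assumes "\<And>x x'. \<bar>f x - f x'\<bar> \<le> L * \<bar>x - x'\<bar>" "\<And>x x'. \<bar>g x - g x'\<bar> \<le> M * \<bar>x - x'\<bar>"
    and "\<And>x. \<bar>f x\<bar> \<le> A" "\<And>x. \<bar>g x\<bar> \<le> B"
    and "L * B \<le> C * K" "A * M \<le> C * K"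
    and K: "l1_norm_unit_square (tensor f g) \<ge> K" and "C \<ge> 0"
  shows "lipschitz_with C (tensor f g)"
  unfolding lipschitz_with_def
proof (intro allI)
  fix u v u' v'
  let ?D = "C * l1_norm_unit_square (tensor f g)"
  have D: "C * K \<le> ?D"
    using K \<open>C \<ge> 0\<close> by (rule mult_left_mono)
  have "A \<ge> 0"
    using assms(3)[of 0] by linarith
  have "tensor f g (u, v) - tensor f g (u', v') = (f u - f u') * g v + f u' * (g v - g v')"
    by (simp add: tensor_def algebra_simps)
  also have "\<bar>\<dots>\<bar> \<le> \<bar>f u - f u'\<bar> * \<bar>g v\<bar> + \<bar>f u'\<bar> * \<bar>g v - g v'\<bar>"
    by (metis abs_mult abs_triangle_ineq)
  also have "\<dots> \<le> (L * \<bar>u - u'\<bar>) * B + A * (M * \<bar>v - v'\<bar>)"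
  proof (intro add_mono mult_mono)
    show "0 \<le> L * \<bar>u - u'\<bar>"
      using assms(1)[of u u'] by linarith
  qed (use assms \<open>A \<ge> 0\<close> in auto)
  also have "\<dots> = (L * B) * \<bar>u - u'\<bar> + (A * M) * \<bar>v - v'\<bar>"
    by simp
  also have "\<dots> \<le> ?D * \<bar>u - u'\<bar> + ?D * \<bar>v - v'\<bar>"
    by (intro add_mono mult_right_mono) (use assms D in linarith)+
  finally show "\<bar>tensor f g (u, v) - tensor f g (u', v')\<bar> \<le> ?D * (\<bar>u - u'\<bar> + \<bar>v - v'\<bar>)"
    by (simp add: algebra_simps)
qed

section \<open>Integrability and elementary estimates on the line\<close>

lemma integrable_continuous_vanishing:
  fixes f :: "real \<Rightarrow> real"
  assumes "continuous_on UNIV f" "\<And>x. x \<notin> {a..b} \<Longrightarrow> f x = 0"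
  shows "integrable lborel f"
proof -
  have "integrable lborel (\<lambda>x. indicator {a..b} x *\<^sub>R f x)"
    using assms(1) by (intro borel_integrable_compact) (auto intro: continuous_on_subset)
  also have "(\<lambda>x. indicator {a..b} x *\<^sub>R f x) = f"
    using assms(2) by (auto simp: indicator_def fun_eq_iff)
  finally show ?thesis .
qed

lemma set_integral_const_Icc:
  fixes a b c :: real
  assumes "a \<le> b"
  shows "(LINT x : {a..b} | lborel. c) = (b - a) * c"
  using assms by (simp add: set_lebesgue_integral_def)

lemma integrable_indicator_Icc:
  fixes a b c :: real
  shows "integrable lborel (\<lambda>x. indicator {a..b} x *\<^sub>R c)"
  by (intro borel_integrable_compact) auto

lemma abs_sin_diff_le:
  fixes x y :: real
  shows "\<bar>sin x - sin y\<bar> \<le> \<bar>x - y\<bar>"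
proof -
  have "\<bar>sin x - sin y\<bar> = 2 * \<bar>sin ((x - y) / 2)\<bar> * \<bar>cos ((x + y) / 2)\<bar>"
    by (simp add: sin_diff_sin abs_mult)
  also have "\<dots> \<le> 2 * \<bar>sin ((x - y) / 2)\<bar> * 1"
    by (intro mult_left_mono) auto
  also have "\<dots> \<le> \<bar>x - y\<bar>"
    using abs_sin_x_le_abs_x[of "(x - y) / 2"] by simp
  finally show ?thesis .
qed

lemma set_integrable_continuous:
  fixes f :: "real \<Rightarrow> real"
  assumes "continuous_on UNIV f" "A \<in> sets borel" "A \<subseteq> {a..b}"
  shows "set_integrable lborel A f"
proof (rule set_integrable_subset[OF _ _ assms(3)])
  show "set_integrable lborel {a..b} f"
    using assms(1) unfolding set_integrable_def
    by (intro borel_integrable_compact) (auto intro: continuous_on_subset)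
qed (use assms in auto)


section \<open>The tent function\<close>

definition tent :: "real \<Rightarrow> real" where
  "tent x = max 0 (1/4 - \<bar>x - 1/2\<bar>)"

lemma tent_nonneg: "tent x \<ge> 0"
  and tent_le: "tent x \<le> 1/4"
  and tent_lipschitz: "\<bar>tent x - tent y\<bar> \<le> \<bar>x - y\<bar>"
  and tent_eq_0: "x \<notin> {1/4..3/4} \<Longrightarrow> tent x = 0"
  and tent_ge_middle: "x \<in> {3/8..5/8} \<Longrightarrow> tent x \<ge> 1/8"
  by (auto simp: tent_def max_def abs_if split: if_splits)

lemma continuous_tent: "continuous_on UNIV tent"
  unfolding tent_def by (intro continuous_intros)

text \<open>The height 1/8 on the middle quarter contributes 1/8 * 1/4. The exact value is 1/16;
  this crude bound only enters the size of the Lipschitz constants.\<close>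

lemma integral_tent_ge: "(LINT x : {0..1} | lborel. tent x) \<ge> 1/32"
proof -
  have "1/32 = (LINT x : {3/8..5/8::real} | lborel. 1/8 :: real)"
    by (simp add: set_integral_const_Icc)
  also have "\<dots> \<le> (LINT x : {0..1} | lborel. tent x)"
    unfolding set_lebesgue_integral_def
  proof (rule integral_mono[OF integrable_indicator_Icc])
    show "integrable lborel (\<lambda>x. indicator {0..1} x *\<^sub>R tent x)"
      using set_integrable_continuous[OF continuous_tent, of "{0..1}" 0 1]
      by (simp add: set_integrable_def)
  qed (use tent_ge_middle tent_nonneg in \<open>auto simp: indicator_def\<close>)
  finally show ?thesis .
qed

lemma integrable_tent_sq: "integrable lborel (\<lambda>x. (tent x)\<^sup>2)"
  by (rule integrable_continuous_vanishing[of _ "1/4" "3/4"])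
    (auto intro!: continuous_intros continuous_tent simp: tent_eq_0)

text \<open>Maximal height 1/4, squared, times the length 1/2 of the support. It bounds the
  denominator of the L2 ratio from above.\<close>

lemma integral_tent_sq_le: "(LINT x | lborel. (tent x)\<^sup>2) \<le> 1/32"
proof -
  have "(LINT x | lborel. (tent x)\<^sup>2) \<le> (LINT x : {1/4..3/4::real} | lborel. 1/16 :: real)"
    unfolding set_lebesgue_integral_def
  proof (rule integral_mono[OF integrable_tent_sq])
    fix x
    have "(tent x)\<^sup>2 \<le> (1/4)\<^sup>2"
      by (rule power_mono[OF tent_le tent_nonneg])
    then show "(tent x)\<^sup>2 \<le> indicator {1/4..3/4} x *\<^sub>R (1/16)"
      using tent_eq_0[of x] by (auto simp: indicator_def power2_eq_square)
  qed (rule integrable_indicator_Icc)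
  then show ?thesis by (simp add: set_integral_const_Icc)
qed

lemma integral_tent_sq_pos: "(LINT x | lborel. (tent x)\<^sup>2) > 0"
proof -
  have "1/256 = (LINT x : {3/8..5/8::real} | lborel. 1/64 :: real)"
    by (simp add: set_integral_const_Icc)
  also have "\<dots> \<le> (LINT x | lborel. (tent x)\<^sup>2)"
    unfolding set_lebesgue_integral_def
  proof (rule integral_mono[OF _ integrable_tent_sq])
    fix x
    have "(1/8)\<^sup>2 \<le> (tent x)\<^sup>2" if "x \<in> {3/8..5/8}"
      by (rule power_mono) (use tent_ge_middle[OF that] in auto)
    then show "indicator {3/8..5/8} x *\<^sub>R (1/64) \<le> (tent x)\<^sup>2"
      by (auto simp: indicator_def power2_eq_square)
  qed simp
  finally show ?thesis by simp
qed


section \<open>The truncated sine wave\<close>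

text \<open>Clamping the argument to [a, b], instead of multiplying by an indicator, keeps the
  function Lipschitz; since the sine vanishes at the integers \<open>a\<close> and \<open>b\<close>,
  the clamped wave is zero outside when \<open>a \<le> b\<close>.\<close>

definition wave :: "int \<Rightarrow> int \<Rightarrow> real \<Rightarrow> real" where
  "wave a b t = sin (2 * pi * max a (min b t))"

lemma sin_2pi_int: "sin (2 * pi * real_of_int k) = 0"
  using sin_integer_2pi[of "real_of_int k"] by simp

lemma cos_2pi_int: "cos (2 * pi * real_of_int k) = 1"
  using cos_integer_2pi[of "real_of_int k"] by simp

lemma abs_wave_le: "\<bar>wave a b t\<bar> \<le> 1"
  by (simp add: wave_def)

lemma wave_lipschitz: "\<bar>wave a b t - wave a b t'\<bar> \<le> 2 * pi * \<bar>t - t'\<bar>"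
proof -
  let ?c = "\<lambda>t. max (real_of_int a) (min (real_of_int b) t)"
  have "\<bar>wave a b t - wave a b t'\<bar> \<le> \<bar>2 * pi * ?c t - 2 * pi * ?c t'\<bar>"
    unfolding wave_def by (rule abs_sin_diff_le)
  also have "\<dots> = 2 * pi * \<bar>?c t - ?c t'\<bar>"
    by (simp add: abs_mult flip: right_diff_distrib)
  also have "\<dots> \<le> 2 * pi * \<bar>t - t'\<bar>"
    by (intro mult_left_mono) (auto simp: max_def min_def)
  finally show ?thesis .
qed

lemma continuous_wave: "continuous_on UNIV (wave a b)"
  unfolding wave_def by (intro continuous_intros)

lemma wave_inside: "t \<in> {real_of_int a..real_of_int b} \<Longrightarrow> wave a b t = sin (2 * pi * t)"
  by (auto simp: wave_def)

lemma wave_outside: "a \<le> b \<Longrightarrow> t \<notin> {real_of_int a<..<real_of_int b} \<Longrightarrow> wave a b t = 0"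
  by (auto simp: wave_def max_def min_def sin_2pi_int)

text \<open>With integer cut-offs a unit cell lies either wholly inside [a, b], where it carries one
  full period, or wholly outside, where the wave is zero. This cancellation makes the perturbation
  invisible in the image.\<close>

lemma integral_wave_cell:
  assumes "a \<le> b"
  shows "(LINT t : {real_of_int k ..< real_of_int k + 1} | lborel. wave a b t) = 0"
proof (cases "a \<le> k \<and> k < b")
  case True
  have end0: "sin (2 * pi * (real_of_int k + 1)) = 0"
    using sin_2pi_int[of "k + 1"] by simp
  have end1: "cos (2 * pi * (real_of_int k + 1)) = 1"
    using cos_2pi_int[of "k + 1"] by simp
  have "real_of_int a \<le> k" "real_of_int k + 1 \<le> b"
    using True by linarith+
  \<comment> \<open>Passing to the closed interval, as the fundamental theorem of calculus requires,
    leaves the integrand unchanged: by \<open>end0\<close> the sine is zero at the added right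
    endpoint.\<close>
  then have "(LINT t : {real_of_int k ..< real_of_int k + 1} | lborel. wave a b t) =
      (LINT t | lborel. sin (2 * pi * t) * indicator {real_of_int k..real_of_int k + 1} t)"
    unfolding set_lebesgue_integral_def using end0
    by (intro Bochner_Integration.integral_cong)
      (auto simp: indicator_def wave_inside order_le_less)
  also have "\<dots> = - cos (2 * pi * (real_of_int k + 1)) / (2 * pi) - - cos (2 * pi * real_of_int k) / (2 * pi)"
    by (rule integral_FTC_Icc_real) (auto intro!: derivative_eq_intros)
  finally show ?thesis
    by (simp add: end1 cos_2pi_int)
next
  case False
  then have "k + 1 \<le> a \<or> b \<le> k"
    by linarith
  then have "real_of_int k + 1 \<le> a \<or> real_of_int b \<le> k"
    by linarith
  then have "\<forall>t\<in>{real_of_int k ..< real_of_int k + 1}. wave a b t = 0"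
    using wave_outside[OF assms] by auto
  then have "(LINT t : {real_of_int k ..< real_of_int k + 1} | lborel. wave a b t) =
      (LINT t : {real_of_int k ..< real_of_int k + 1} | lborel. 0)"
    by (intro set_lebesgue_integral_cong) auto
  then show ?thesis
    by simp
qed

text \<open>The mean of the squared sine over each of the \<open>b - a\<close> periods is
  1/2.\<close>

lemma integral_wave_sq:
  assumes "a \<le> b"
  shows "(LINT t | lborel. (wave a b t)\<^sup>2) = real_of_int (b - a) / 2"
proof -
  let ?F = "\<lambda>t. t / 2 - sin (2 * pi * t) * cos (2 * pi * t) / (4 * pi)"
  have "(LINT t | lborel. (wave a b t)\<^sup>2) =
      (LINT t | lborel. (sin (2 * pi * t))\<^sup>2 * indicator {real_of_int a..real_of_int b} t)"
    by (intro Bochner_Integration.integral_cong)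
      (auto simp: indicator_def wave_inside wave_outside[OF assms])
  also have "\<dots> = ?F b - ?F a"
  proof (rule integral_FTC_Icc_real)
    fix t :: real
    have "(?F has_real_derivative 1/2 - ((cos (2 * pi * t))\<^sup>2 - (sin (2 * pi * t))\<^sup>2) / 2) (at t)"
      by (auto intro!: derivative_eq_intros simp: field_simps power2_eq_square)
    also have "1/2 - ((cos (2 * pi * t))\<^sup>2 - (sin (2 * pi * t))\<^sup>2) / 2 = (sin (2 * pi * t))\<^sup>2"
      unfolding cos_squared_eq by algebra
    finally show "(?F has_real_derivative (sin (2 * pi * t))\<^sup>2) (at t)" .
  qed (use assms in auto)
  finally show ?thesis
    by (simp add: sin_2pi_int diff_divide_distrib)
qed


section \<open>The perturbation of the tent\<close>

text \<open>In the coordinate t = (x + \<tau>)/h the pixel edges are integers. The wave runs over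
  the columns from \<open>a\<close> to \<open>b\<close>, which in template coordinates lie in the
  middle quarter [3/8, 5/8] and have total width at least 3/16.\<close>

locale perturbed_tent =
  fixes h \<tau> :: real and a b :: int
  assumes h: "0 < h" "h \<le> 1/32"
    and ab: "a \<le> b" "3/8 \<le> a * h - \<tau>" "b * h - \<tau> \<le> 5/8" "3/16 \<le> (b - a) * h"
begin

definition ripple :: "real \<Rightarrow> real" where
  "ripple x = 2 * h * wave a b ((x + \<tau>) / h)"

definition bumpy :: "real \<Rightarrow> real" where
  "bumpy x = tent x + ripple x"

text \<open>Where the ripple is nonzero the tent is at least 1/8, while the amplitude 2h is at most
  1/16. Non-negativity, the support and the L1 lower bound of \<open>bumpy\<close> all follow from
  this.\<close>

lemma ripple_le: "\<bar>ripple x\<bar> \<le> tent x / 2"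
proof (cases "(x + \<tau>) / h \<in> {real_of_int a<..<real_of_int b}")
  case True
  then have "a * h < x + \<tau>" "x + \<tau> < b * h"
    using h by (auto simp: field_simps)
  then have "tent x \<ge> 1/8"
    using ab by (intro tent_ge_middle) auto
  moreover have "\<bar>ripple x\<bar> \<le> 2 * h * 1"
    unfolding ripple_def abs_mult using h abs_wave_le by (intro mult_mono) auto
  ultimately show ?thesis
    using h by simp
next
  case False
  then show ?thesis
    using tent_nonneg[of x] by (simp add: ripple_def wave_outside[OF ab(1)])
qed

text \<open>Amplitude 2h times frequency 1/h: the factor h cancels, so the slope is independent of
  the resolution.\<close>

lemma ripple_lipschitz: "\<bar>ripple x - ripple y\<bar> \<le> 4 * pi * \<bar>x - y\<bar>"
proof -
  have "ripple x - ripple y = 2 * h * (wave a b ((x + \<tau>) / h) - wave a b ((y + \<tau>) / h))"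
    by (simp add: ripple_def algebra_simps)
  also have "\<bar>\<dots>\<bar> \<le> 2 * h * (2 * pi * \<bar>(x + \<tau>) / h - (y + \<tau>) / h\<bar>)"
    using h wave_lipschitz[of a b "(x + \<tau>) / h" "(y + \<tau>) / h"] by (simp add: abs_mult)
  also have "(x + \<tau>) / h - (y + \<tau>) / h = (x - y) / h"
    by (simp flip: diff_divide_distrib)
  finally show ?thesis
    using h by simp
qed

lemma continuous_ripple: "continuous_on UNIV ripple"
  unfolding ripple_def using h
  by (intro continuous_intros continuous_on_compose2[OF continuous_wave]) auto

lemma continuous_bumpy: "continuous_on UNIV bumpy"
  unfolding bumpy_def by (intro continuous_intros continuous_tent continuous_ripple)

lemma bumpy_bounds: "tent x / 2 \<le> bumpy x" "bumpy x \<le> 3/8" "bumpy x \<ge> 0"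
  using ripple_le[of x] tent_le[of x] tent_nonneg[of x] by (auto simp: bumpy_def)

lemma ripple_eq_0: "x \<notin> {1/4..3/4} \<Longrightarrow> ripple x = 0"
  using ripple_le[of x] tent_eq_0[of x] by simp

lemma bumpy_eq_0: "x \<notin> {1/4..3/4} \<Longrightarrow> bumpy x = 0"
  by (simp add: bumpy_def tent_eq_0 ripple_eq_0)

lemma bumpy_lipschitz: "\<bar>bumpy x - bumpy y\<bar> \<le> 17 * \<bar>x - y\<bar>"
proof -
  \<comment> \<open>The bound pi < 4 gives the ripple slope at most 16; the tent adds slope 1, for a
    total of 17.\<close>
  have "4 * pi * \<bar>x - y\<bar> \<le> 16 * \<bar>x - y\<bar>"
    using pi_less_4 by (intro mult_right_mono) auto
  then show ?thesis
    using ripple_lipschitz[of x y] tent_lipschitz[of x y]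
      abs_triangle_ineq[of "tent x - tent y" "ripple x - ripple y"]
    by (simp add: bumpy_def algebra_simps)
qed

lemma integrable_ripple_sq: "integrable lborel (\<lambda>x. (ripple x)\<^sup>2)"
  by (rule integrable_continuous_vanishing[of _ "1/4" "3/4"])
    (auto intro!: continuous_intros continuous_ripple simp: ripple_eq_0)

text \<open>Squared amplitude 4h^2, mean 1/2 of the squared sine, and width at least 3/16 multiply
  to 3/8 * h^2.\<close>

lemma integral_ripple_sq_ge: "(LINT x | lborel. (ripple x)\<^sup>2) \<ge> 3/8 * h\<^sup>2"
proof -
  have "(LINT x | lborel. (ripple x)\<^sup>2) = \<bar>h\<bar> *\<^sub>R (LINT x | lborel. (ripple (- \<tau> + h * x))\<^sup>2)"
    by (rule lborel_integral_real_affine) (use h in simp)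
  also have "(\<lambda>x. (ripple (- \<tau> + h * x))\<^sup>2) = (\<lambda>x. 4 * h\<^sup>2 * (wave a b x)\<^sup>2)"
    using h by (simp add: ripple_def fun_eq_iff power_mult_distrib)
  also have "\<bar>h\<bar> *\<^sub>R (LINT x | lborel. 4 * h\<^sup>2 * (wave a b x)\<^sup>2) = 2 * h\<^sup>2 * ((b - a) * h)"
    using h by (simp add: integral_wave_sq[OF ab(1)])
  also have "\<dots> \<ge> 2 * h\<^sup>2 * (3/16)"
    using ab by (intro mult_left_mono) auto
  finally show ?thesis
    by simp
qed

text \<open>For x = \<xi> u - \<tau> the shift cancels and (x + \<tau>)/h = d u, so substituting t =
  d u turns the ripple over a pixel into the wave over a unit cell, whose integral is zero.\<close>

lemma integral_bumpy_cell:
  fixes d j :: nat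
  assumes "d > 0" "\<xi> = h * d"
  defines "I \<equiv> {(real j - 1) / real d ..< real j / real d}"
  shows "(LINT u : I | lborel. bumpy (\<xi> * u - \<tau>)) = (LINT u : I | lborel. tent (\<xi> * u - \<tau>))"
proof -
  have int: "set_integrable lborel I (\<lambda>u. f (\<xi> * u - \<tau>))" if "continuous_on UNIV f" for f :: "real \<Rightarrow> real"
  proof (rule set_integrable_continuous[of _ _ "(real j - 1) / real d" "real j / real d"])
    show "continuous_on UNIV (\<lambda>u. f (\<xi> * u - \<tau>))"
      by (rule continuous_on_compose2[OF that]) (auto intro!: continuous_intros)
  qed (auto simp: I_def)
  have "(LINT u : I | lborel. ripple (\<xi> * u - \<tau>)) =
      2 * h * (LINT u | lborel. indicator I u * wave a b (d * u))"
    using h assms(2) by (simp add: set_lebesgue_integral_def ripple_def mult.left_commute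
      flip: Bochner_Integration.integral_mult_right_zero)
  also have "(LINT u | lborel. indicator I u * wave a b (d * u)) =
      \<bar>1 / real d\<bar> *\<^sub>R (LINT t | lborel. indicator I (0 + 1 / d * t) * wave a b (d * (0 + 1 / d * t)))"
    by (rule lborel_integral_real_affine) (use assms in simp)
  \<comment> \<open>Pixels are counted from 1, so pixel \<open>j\<close> becomes the cell starting
    at j - 1; the subtraction is done in \<open>int\<close> to avoid truncation at zero.\<close>
  also have "(\<lambda>t. indicator I (0 + 1 / d * t) * wave a b (d * (0 + 1 / d * t))) =
      (\<lambda>t. indicator {real_of_int (int j - 1) ..< real_of_int (int j - 1) + 1} t *\<^sub>R wave a b t)"
    using assms(1) by (auto simp: I_def indicator_def fun_eq_iff divide_simps)
  also have "(LINT t | lborel. \<dots> t) = 0"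
    using integral_wave_cell[OF ab(1), of "int j - 1"] by (simp add: set_lebesgue_integral_def)
  finally show ?thesis
    unfolding bumpy_def by (simp add: int continuous_tent continuous_ripple)
qed

lemma integral_bumpy_ge: "(LINT x : {0..1} | lborel. bumpy x) \<ge> 1/64"
proof -
  have i: "set_integrable lborel {0..1} f" if "continuous_on UNIV f" for f :: "real \<Rightarrow> real"
    by (rule set_integrable_continuous[OF that]) auto
  have "1/64 \<le> (LINT x : {0..1} | lborel. tent x) / 2"
    using integral_tent_ge by simp
  also have "\<dots> = (LINT x : {0..1} | lborel. tent x / 2)"
    by simp
  also have "\<dots> \<le> (LINT x : {0..1} | lborel. bumpy x)"
    by (rule set_integral_mono)
      (use bumpy_bounds in \<open>auto intro!: i continuous_intros continuous_tent continuous_bumpy\<close>)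
  finally show ?thesis .
qed

end


section \<open>The two templates\<close>

lemma l1_norm_tensor:
  assumes "continuous_on UNIV f" "continuous_on UNIV g" "\<And>x. f x \<ge> 0" "\<And>x. g x \<ge> 0"
  shows "l1_norm_unit_square (tensor f g) = (LINT x : {0..1} | lborel. f x) * (LINT y : {0..1} | lborel. g y)"
proof -
  have "(\<lambda>z. \<bar>tensor f g z\<bar>) = tensor f g"
    using assms by (simp add: tensor_def fun_eq_iff)
  moreover have "set_integrable lborel {0..1} f" "set_integrable lborel {0..1} g"
    using assms by (auto intro: set_integrable_continuous)
  ultimately show ?thesis
    unfolding l1_norm_unit_square_def by (simp add: set_integral_tensor)
qed

lemma l2_norm_tensor:
  assumes "integrable lborel (\<lambda>x. (f x)\<^sup>2)" "integrable lborel (\<lambda>x. (g x)\<^sup>2)"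
  shows "l2_norm (tensor f g) = sqrt (LINT x | lborel. (f x)\<^sup>2) * sqrt (LINT x | lborel. (g x)\<^sup>2)"
proof -
  have "(\<lambda>z. (tensor f g z)\<^sup>2) = tensor (\<lambda>x. (f x)\<^sup>2) (\<lambda>x. (g x)\<^sup>2)"
    by (simp add: tensor_def fun_eq_iff power_mult_distrib)
  then show ?thesis
    unfolding l2_norm_def by (simp add: integral_tensor[OF assms] real_sqrt_mult)
qed

lemma pixel_value_tensor:
  assumes "continuous_on UNIV f" "continuous_on UNIV g"
  shows "pixel_value d \<eta> \<xi> \<xi>' \<tau> \<tau>' (tensor f g) j l = (real d)\<^sup>2 * \<eta> *
    ((LINT u : {(real j - 1) / real d ..< real j / real d} | lborel. f (\<xi> * u - \<tau>)) *
     (LINT v : {(real l - 1) / real d ..< real l / real d} | lborel. g (\<xi>' * v - \<tau>')))"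
proof -
  have "set_integrable lborel {x..<y} (\<lambda>u. k (c * u - t))" if "continuous_on UNIV k"
    for k :: "real \<Rightarrow> real" and x y c t
  proof (rule set_integrable_continuous[of _ _ x y])
    show "continuous_on UNIV (\<lambda>u. k (c * u - t))"
      by (rule continuous_on_compose2[OF that]) (auto intro!: continuous_intros)
  qed auto
  moreover have "(\<lambda>z. tensor f g (\<xi> * fst z - \<tau>, \<xi>' * snd z - \<tau>')) =
      tensor (\<lambda>u. f (\<xi> * u - \<tau>)) (\<lambda>v. g (\<xi>' * v - \<tau>'))"
    by (simp add: tensor_def fun_eq_iff)
  ultimately show ?thesis
    using assms unfolding pixel_value_def pixel_cell_def by (simp add: set_integral_tensor)
qed

lemma tensor_nonneg: "(\<And>x. f x \<ge> 0) \<Longrightarrow> (\<And>x. g x \<ge> 0) \<Longrightarrow> tensor f g z \<ge> 0"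
  by (simp add: tensor_def)

lemma tensor_support:
  "(\<And>x. x \<notin> A \<Longrightarrow> f x = 0) \<Longrightarrow> (\<And>x. x \<notin> B \<Longrightarrow> g x = 0) \<Longrightarrow> {z. tensor f g z \<noteq> 0} \<subseteq> A \<times> B"
  by (force simp: tensor_def)

text \<open>The constant is slope 1 times height 1/4, divided by the L1 lower bound 1/32 * 1/32 =
  1/1024.\<close>

lemma lipschitz_with_tent: "lipschitz_with 256 (tensor tent tent)"
proof (rule lipschitz_with_tensor)
  have "1/1024 = 1/32 * (1/32 :: real)"
    by simp
  also have "\<dots> \<le> l1_norm_unit_square (tensor tent tent)"
    unfolding l1_norm_tensor[OF continuous_tent continuous_tent tent_nonneg tent_nonneg]
    by (intro mult_mono) (use integral_tent_ge in auto)
  finally show "1/1024 \<le> l1_norm_unit_square (tensor tent tent)" .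
  show "\<bar>tent x\<bar> \<le> 1/4" for x
    using tent_le tent_nonneg by simp
  then show "\<bar>tent x\<bar> \<le> 1/4" for x .
  show "\<bar>tent x - tent y\<bar> \<le> 1 * \<bar>x - y\<bar>" for x y
    using tent_lipschitz by simp
  then show "\<bar>tent x - tent y\<bar> \<le> 1 * \<bar>x - y\<bar>" for x y .
qed auto

context perturbed_tent
begin

text \<open>The dominant term is slope 17 times height 1/4, divided by the L1 lower bound 1/2048:
  17/4 * 2048 = 8704, whatever \<open>h\<close> is.\<close>

lemma lipschitz_with_bumpy: "lipschitz_with 8704 (tensor bumpy tent)"
proof (rule lipschitz_with_tensor)
  have "1/2048 = 1/64 * (1/32 :: real)"
    by simp
  also have "\<dots> \<le> l1_norm_unit_square (tensor bumpy tent)"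
    unfolding l1_norm_tensor[OF continuous_bumpy continuous_tent bumpy_bounds(3) tent_nonneg]
    by (intro mult_mono) (use integral_tent_ge integral_bumpy_ge in auto)
  finally show "1/2048 \<le> l1_norm_unit_square (tensor bumpy tent)" .
  show "\<bar>bumpy x\<bar> \<le> 3/8" for x
    using bumpy_bounds by simp
  show "\<bar>tent x\<bar> \<le> 1/4" for x
    using tent_le tent_nonneg by simp
  show "\<bar>bumpy x - bumpy y\<bar> \<le> 17 * \<bar>x - y\<bar>" for x y
    by (rule bumpy_lipschitz)
  show "\<bar>tent x - tent y\<bar> \<le> 1 * \<bar>x - y\<bar>" for x y
    using tent_lipschitz by simp
qed auto

text \<open>The difference of the templates is \<open>tensor ripple tent\<close>, so the factor in
  the second variable cancels and the ratio of the norms of \<open>ripple\<close> and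
  \<open>tent\<close> remains.\<close>

lemma l2_ratio_ge: "l2_norm (\<lambda>z. tensor bumpy tent z - tensor tent tent z) / l2_norm (tensor tent tent) \<ge> h"
proof -
  let ?P = "LINT x | lborel. (tent x)\<^sup>2" and ?R = "LINT x | lborel. (ripple x)\<^sup>2"
  have P: "0 < ?P"
    by (rule integral_tent_sq_pos)
  have "h\<^sup>2 * ?P \<le> h\<^sup>2 * (1/32)"
    using integral_tent_sq_le by (intro mult_left_mono) auto
  also have "\<dots> \<le> ?R"
    using integral_ripple_sq_ge zero_le_power2[of h] by linarith
  finally have "h\<^sup>2 \<le> ?R / ?P"
    using P by (simp add: field_simps)
  then have "h \<le> sqrt (?R / ?P)"
    by (rule real_le_rsqrt)
  \<comment> \<open>Expanding the fraction by \<open>sqrt ?P\<close> restores the second factor of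
    each tensor norm.\<close>
  also have "\<dots> = sqrt ?R * sqrt ?P / (sqrt ?P * sqrt ?P)"
    using P by (simp add: real_sqrt_divide del: real_sqrt_mult_self)
  also have "\<dots> = l2_norm (tensor ripple tent) / l2_norm (tensor tent tent)"
    by (simp only: l2_norm_tensor integrable_ripple_sq integrable_tent_sq)
  also have "tensor ripple tent = (\<lambda>z. tensor bumpy tent z - tensor tent tent z)"
    by (simp add: tensor_def bumpy_def fun_eq_iff algebra_simps)
  finally show ?thesis .
qed

end

text \<open>Rounding the ends of [3/8, 5/8] inwards to the pixel grid loses at most h on each side,
  which leaves at least 1/4 - 2h \<ge> 3/16.\<close>

lemma ex_perturbed_tent:
  assumes h: "0 < h" "h \<le> 1/32"
  obtains a b where "perturbed_tent h \<tau> a b"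
proof
  let ?a = "\<lceil>(3/8 + \<tau>) / h\<rceil>" and ?b = "\<lfloor>(5/8 + \<tau>) / h\<rfloor>"
  have a: "3/8 + \<tau> \<le> ?a * h" "?a * h \<le> 3/8 + \<tau> + h"
  proof -
    have "(3/8 + \<tau>) / h \<le> ?a" "?a - 1 \<le> (3/8 + \<tau>) / h"
      by linarith+
    then have "3/8 + \<tau> \<le> ?a * h" "(?a - 1) * h \<le> 3/8 + \<tau>"
      using h by (simp_all only: pos_divide_le_eq pos_le_divide_eq)
    then show "3/8 + \<tau> \<le> ?a * h" "?a * h \<le> 3/8 + \<tau> + h"
      by (simp_all add: left_diff_distrib)
  qed
  have b: "?b * h \<le> 5/8 + \<tau>" "5/8 + \<tau> \<le> ?b * h + h"
  proof -
    have "?b \<le> (5/8 + \<tau>) / h" "(5/8 + \<tau>) / h \<le> ?b + 1"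
      by linarith+
    then have "?b * h \<le> 5/8 + \<tau>" "5/8 + \<tau> \<le> (?b + 1) * h"
      using h by (simp_all only: pos_divide_le_eq pos_le_divide_eq)
    then show "?b * h \<le> 5/8 + \<tau>" "5/8 + \<tau> \<le> ?b * h + h"
      by (simp_all add: distrib_right)
  qed
  have len: "3/16 \<le> (real_of_int ?b - ?a) * h"
    using a b h unfolding left_diff_distrib by linarith
  then have "0 < (real_of_int ?b - ?a) * h"
    by linarith
  then have "?a \<le> ?b"
    using h by (simp add: zero_less_mult_iff)
  then show "perturbed_tent h \<tau> ?a ?b"
    using a b h len by unfold_locales auto
qed

text \<open>The order of the quantifiers matters: both Lipschitz constants are fixed before
  \<open>d\<close>, and \<open>f0\<close> is too, whereas \<open>f1\<close> may depend on
  \<open>d\<close>, since its oscillation must match the pixel grid.\<close>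

theorem theorem3p8:
  shows "\<exists>(C0 :: real) (C1 :: real \<Rightarrow> real \<Rightarrow> real).
    \<forall>(\<tau> :: real) (\<tau>' :: real) (\<xi> :: real) (\<xi>' :: real).
      \<xi> \<ge> 1/2 \<and> \<xi>' \<ge> 1/2 \<and>
      - 1/4 \<le> \<tau> \<and> \<tau> \<le> \<xi> - 3/4 \<and>
      - 1/4 \<le> \<tau>' \<and> \<tau>' \<le> \<xi>' - 3/4 \<longrightarrow>
      (\<exists>f0 :: real \<times> real \<Rightarrow> real.
        (\<forall>z. f0 z \<ge> 0) \<and>
        {z. f0 z \<noteq> 0} \<subseteq> {1/4..3/4} \<times> {1/4..3/4} \<and>
        lipschitz_with C0 f0 \<and>
        (\<forall>d :: nat. real d \<ge> 32 * max \<xi> \<xi>' \<longrightarrow>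
          (\<exists>f1 :: real \<times> real \<Rightarrow> real.
            (\<forall>z. f1 z \<ge> 0) \<and>
            {z. f1 z \<noteq> 0} \<subseteq> {1/4..3/4} \<times> {1/4..3/4} \<and>
            lipschitz_with (C1 \<xi> \<xi>') f1 \<and>
            l2_norm (\<lambda>z. f1 z - f0 z) / l2_norm f0 \<ge> 1 / (28 * real d) \<and>
            (\<forall>\<eta>>0. \<forall>j\<in>{1..d}. \<forall>l\<in>{1..d}.
              pixel_value d \<eta> \<xi> \<xi>' \<tau> \<tau>' f1 j l = pixel_value d \<eta> \<xi> \<xi>' \<tau> \<tau>' f0 j l))))"
proof (intro exI[of _ "256 :: real"] exI[of _ "\<lambda>_ _. 8704 :: real"] allI impI)
  fix \<tau> \<tau>' \<xi> \<xi>' :: real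
  assume A: "\<xi> \<ge> 1/2 \<and> \<xi>' \<ge> 1/2 \<and> - 1/4 \<le> \<tau> \<and> \<tau> \<le> \<xi> - 3/4 \<and>
    - 1/4 \<le> \<tau>' \<and> \<tau>' \<le> \<xi>' - 3/4"
  let ?f0 = "tensor tent tent"
  show "\<exists>f0 :: real \<times> real \<Rightarrow> real.
        (\<forall>z. f0 z \<ge> 0) \<and>
        {z. f0 z \<noteq> 0} \<subseteq> {1/4..3/4} \<times> {1/4..3/4} \<and>
        lipschitz_with 256 f0 \<and>
        (\<forall>d :: nat. real d \<ge> 32 * max \<xi> \<xi>' \<longrightarrow>
          (\<exists>f1 :: real \<times> real \<Rightarrow> real.
            (\<forall>z. f1 z \<ge> 0) \<and>
            {z. f1 z \<noteq> 0} \<subseteq> {1/4..3/4} \<times> {1/4..3/4} \<and>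
            lipschitz_with 8704 f1 \<and>
            l2_norm (\<lambda>z. f1 z - f0 z) / l2_norm f0 \<ge> 1 / (28 * real d) \<and>
            (\<forall>\<eta>>0. \<forall>j\<in>{1..d}. \<forall>l\<in>{1..d}.
              pixel_value d \<eta> \<xi> \<xi>' \<tau> \<tau>' f1 j l = pixel_value d \<eta> \<xi> \<xi>' \<tau> \<tau>' f0 j l)))"
  proof (rule exI[of _ ?f0], intro conjI allI impI)
    fix d :: nat
    assume "real d \<ge> 32 * max \<xi> \<xi>'"
    then have d: "real d \<ge> 32 * \<xi>" "d > 0"
      using A by (auto simp: max_def split: if_splits)
    \<comment> \<open>Only the first coordinate is perturbed, so the pixel width in that direction
      is the relevant scale; the resolution hypothesis gives h \<le> 1/32.\<close>
    define h where "h = \<xi> / d"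
    have hd: "0 < h" "h \<le> 1/32" "\<xi> = h * d"
      using A d by (auto simp: h_def field_simps)
    obtain a b where "perturbed_tent h \<tau> a b"
      using ex_perturbed_tent hd by blast
    then interpret perturbed_tent h \<tau> a b .
    let ?f1 = "tensor bumpy tent"
    \<comment> \<open>From \<xi> \<ge> 1/2 one gets h \<ge> 1/(2d), well above the required
      bound.\<close>
    have "1 / (28 * real d) \<le> h"
      using A d by (simp add: h_def field_simps)
    then have ratio: "1 / (28 * real d) \<le> l2_norm (\<lambda>z. ?f1 z - ?f0 z) / l2_norm ?f0"
      using l2_ratio_ge by linarith
    have pixels: "pixel_value d \<eta> \<xi> \<xi>' \<tau> \<tau>' ?f1 j l = pixel_value d \<eta> \<xi> \<xi>' \<tau> \<tau>' ?f0 j l" for \<eta> j l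
      unfolding pixel_value_tensor[OF continuous_bumpy continuous_tent]
        pixel_value_tensor[OF continuous_tent continuous_tent]
      by (simp only: integral_bumpy_cell[OF d(2) hd(3)])
    show "\<exists>f1 :: real \<times> real \<Rightarrow> real.
            (\<forall>z. f1 z \<ge> 0) \<and>
            {z. f1 z \<noteq> 0} \<subseteq> {1/4..3/4} \<times> {1/4..3/4} \<and>
            lipschitz_with 8704 f1 \<and>
            l2_norm (\<lambda>z. f1 z - ?f0 z) / l2_norm ?f0 \<ge> 1 / (28 * real d) \<and>
            (\<forall>\<eta>>0. \<forall>j\<in>{1..d}. \<forall>l\<in>{1..d}.
              pixel_value d \<eta> \<xi> \<xi>' \<tau> \<tau>' f1 j l = pixel_value d \<eta> \<xi> \<xi>' \<tau> \<tau>' ?f0 j l)"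
      by (intro exI[of _ ?f1] conjI allI impI ballI tensor_nonneg bumpy_bounds(3) tent_nonneg
        tensor_support bumpy_eq_0 tent_eq_0 lipschitz_with_bumpy ratio pixels)
  next
    show "{z. ?f0 z \<noteq> 0} \<subseteq> {1/4..3/4} \<times> {1/4..3/4}"
      by (intro tensor_support tent_eq_0)
  qed (simp_all add: tensor_nonneg tent_nonneg lipschitz_with_tent)
qed

end
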